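(* Let $r$ be an odd positive integer, let $\rho=(r,r)$, and let $C_\rho(x,q)=\sum_{w\in S_\rho}x^{\mathrm{des}(w)}q^{\mathrm{maj}(w)}\in\mathbb{Z}[x,q]$. Then $$C_\rho(x,q)=(1+xq^{r})\,\widetilde{C}_\rho(x,q)$$ for some $\widetilde{C}_\rho(x,q)\in\mathbb{Z}[x,q]$ that has no unitary factor.
   Context: $S_\rho$, for $\rho=(r,r)$, is the set of all words $w=w_1\cdots w_{2r}$ in which the letter $1$ occurs $r$ times and the letter $2$ occurs $r$ times. For $w\in S_\rho$, $\mathrm{Des}(w)=\{i\in\{1,\ldots,2r-1\} : w_i>w_{i+1}\}$, $\mathrm{des}(w)=|\mathrm{Des}(w)|$, $\mathrm{maj}(w)=\sum_{i\in\mathrm{Des}(w)}i$. A bivariate polynomial $f(x,y)\in\mathbb{Z}[x,y]$ is called unitary if there exist integers $\alpha,\beta\ge 0$ and $g\in\mathbb{Z}[t]$ such that $f(x,y)=g(x^\alpha y^\beta)$ and all the complex roots of $g$ lie on the unit circle. A unitary factor of a polynomial in $\mathbb{Z}[x,q]$ is a non-constant unitary polynomial dividing it in $\mathbb{Z}[x,q]$. *)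

theory Defs
  imports Complex_Main "HOL-Computational_Algebra.Polynomial"
begin

text \<open>
  Words are 0-based lists, whereas descent positions are 1-based: position \<open>i\<close> compares
  \<open>w\<^sub>i = w ! (i - 1)\<close> with \<open>w\<^sub>i\<^sub>+\<^sub>1 = w ! i\<close>.
\<close>

definition balanced_words :: "nat \<Rightarrow> nat list set" where
  "balanced_words r =
     {w. length w = 2 * r \<and> set w \<subseteq> {1, 2} \<and> count_list w 1 = r \<and> count_list w 2 = r}"

definition Des :: "nat list \<Rightarrow> nat set" where
  "Des w = {i. 1 \<le> i \<and> i < length w \<and> w ! (i - 1) > w ! i}"

definition des :: "nat list \<Rightarrow> nat" where
  "des w = card (Des w)"

definition maj :: "nat list \<Rightarrow> nat" where
  "maj w = \<Sum>(Des w)"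

lemma finite_balanced_words: "finite (balanced_words r)"
  by (rule finite_subset[OF _ finite_lists_length_eq[of "{1, 2}" "2 * r"]])
     (auto simp: balanced_words_def)

lemma finite_Des: "finite (Des w)"
  by (rule finite_subset[of _ "{..<length w}"]) (auto simp: Des_def)

text \<open>
  The ring \<open>\<int>[x, q]\<close> is represented as \<open>int poly poly\<close>, i.e. \<open>(\<int>[q])[x]\<close>: the outer
  variable is the first one (\<open>x\<close>), the inner variable the second one (\<open>q\<close> or \<open>y\<close>).
\<close>

definition bimonom :: "nat \<Rightarrow> nat \<Rightarrow> int poly poly" where
  "bimonom a b = monom (monom 1 b) a"

lemma bimonom_eq: "bimonom a b = [:0, 1:] ^ a * [:[:0, 1:]:] ^ b"
proof -
  have 1: "[:0, 1:] ^ a = (monom 1 a :: int poly poly)"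
    by (simp add: monom_altdef)
  have 2: "[:[:0, 1:]:] ^ b = ([:monom 1 b:] :: int poly poly)"
    by (induction b) (simp_all add: monom_Suc one_pCons)
  show ?thesis
    unfolding 1 2 bimonom_def by (simp add: smult_monom)
qed

definition C_poly :: "nat \<Rightarrow> int poly poly" where
  "C_poly r = (\<Sum>w\<in>balanced_words r. bimonom (des w) (maj w))"

text \<open>\<open>g(x\<^sup>a y\<^sup>b)\<close>, where \<open>of_int\<close> embeds \<open>\<int>\<close> into \<open>\<int>[x, y]\<close> coefficientwise.\<close>

definition unitary :: "int poly poly \<Rightarrow> bool" where
  "unitary f \<longleftrightarrow>
     (\<exists>(a::nat) (b::nat) (g::int poly).
        f = poly (map_poly of_int g) (bimonom a b) \<and>
        (\<forall>z::complex. poly (map_poly of_int g) z = 0 \<longrightarrow> cmod z = 1))"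

definition unitary_factor :: "int poly poly \<Rightarrow> int poly poly \<Rightarrow> bool" where
  "unitary_factor f p \<longleftrightarrow> unitary f \<and> (\<nexists>c::int. f = [:[:c:]:]) \<and> f dvd p"

end

theory Submission
  imports Defs "HOL-Computational_Algebra.Fundamental_Theorem_Algebra"
begin

text \<open>
  The argument first computes \<open>C\<^sub>\<rho>\<close> and then specialises it to \<open>q = 1\<close>, which is all that is
  needed to exclude unitary factors.

  Adding one letter at a time gives a three-term recursion in the two letter multiplicities
  (\<open>word_sum_Suc_Suc\<close>), whose solution is
  \<open>\<Sum>\<^sub>k x\<^sup>k q\<^sup>k e\<^sub>k(1, q, \<dots>, q\<^sup>a\<^sup>-\<^sup>1) e\<^sub>k(1, q, \<dots>, q\<^sup>b\<^sup>-\<^sup>1)\<close> (\<open>word_sum_eq\<close>). For \<open>a = b = r\<close>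
  let \<open>c\<^sub>k\<close> be the coefficient of \<open>x\<^sup>k\<close>. Each \<open>e\<^sub>k\<close> is a power of \<open>q\<close> times a Gaussian binomial
  coefficient, and the symmetry of these gives \<open>c\<^bsub>r-k\<^esub> = c\<^sub>k (q\<^sup>r)\<^bsup>r-2k\<^esup>\<close> for \<open>2k \<le> r\<close>. Hence the terms
  \<open>k\<close> and \<open>r - k\<close> together make \<open>c\<^sub>k x\<^sup>k (1 + (x q\<^sup>r)\<^bsup>r-2k\<^esup>)\<close>. When \<open>r\<close> is odd, so is \<open>r - 2k\<close>, and every
  such pair is divisible by \<open>1 + x q\<^sup>r\<close> (\<open>word_sum_dvd\<close>).

  At \<open>q = 1\<close> the polynomial becomes \<open>\<Sum>\<^sub>k (r choose k)\<^sup>2 x\<^sup>k\<close>, which is a combination of the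
  polynomials \<open>x\<^sup>j (1 + x)\<^bsup>r-2j\<^esup>\<close> with positive coefficients (\<open>sum_binomial_squares\<close>). For odd \<open>r\<close> a factor
  \<open>1 + x\<close> splits off, and the quotient contains only even powers of \<open>1 + x\<close>. On the unit circle
  \<open>(1 + x)\<^sup>2 / x = 2 + 2 Re x\<close> is a nonnegative real number, so the quotient is there a power of \<open>x\<close>
  times a positive number (\<open>cofactor_unit_circle_nonzero\<close>). This quotient is the specialisation of
  the cofactor of \<open>1 + x q\<^sup>r\<close> in \<open>C\<^sub>\<rho>\<close>, which therefore has no zero with \<open>q = 1\<close> and \<open>x\<close> on the unit
  circle.

  Now let \<open>g(x\<^sup>\<alpha> q\<^sup>\<beta>)\<close> be unitary and divide this cofactor. If \<open>\<alpha> > 0\<close> and \<open>g\<close> had a root, an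
  \<open>\<alpha>\<close>-th root of it would be a zero of the kind just excluded, so \<open>g\<close> is constant. If \<open>\<alpha> = 0\<close>, the
  factor is a polynomial in \<open>q\<close> alone and divides the coefficient of \<open>x\<^sup>0\<close>, which is a divisor of
  \<open>1\<close> because only the weakly increasing word has no descents; again the factor is constant
  (\<open>unitary_dvd_imp_constant\<close>).
\<close>

section \<open>Words in two letters\<close>

definition words :: "nat \<Rightarrow> nat \<Rightarrow> nat list set" where
  "words a b = {w. set w \<subseteq> {1, 2} \<and> count_list w 1 = a \<and> count_list w 2 = b}"

lemma length_eq_counts:
  assumes "set w \<subseteq> {1, 2 :: nat}"
  shows "length w = count_list w 1 + count_list w 2"
  using assms by (induction w) auto

lemma length_words: "w \<in> words a b \<Longrightarrow> length w = a + b"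
  using length_eq_counts unfolding words_def by blast

lemma balanced_words_eq: "balanced_words r = words r r"
  using length_eq_counts unfolding balanced_words_def words_def by fastforce

lemma finite_words: "finite (words a b)"
proof (rule finite_subset)
  show "words a b \<subseteq> {w. set w \<subseteq> {1, 2} \<and> length w = a + b}"
    using length_words by (auto simp: words_def)
qed (simp add: finite_lists_length_eq)

lemma words_Suc_Suc:
  "words (Suc a) (Suc b) = (\<lambda>w. w @ [2]) ` words (Suc a) b \<union> (\<lambda>w. w @ [1]) ` words a (Suc b)"
proof (intro equalityI subsetI)
  fix w assume w: "w \<in> words (Suc a) (Suc b)"
  then have "w \<noteq> []" by (auto simp: words_def)
  then obtain u c where "w = u @ [c]" by (metis append_butlast_last_id)
  with w show "w \<in> (\<lambda>w. w @ [2]) ` words (Suc a) b \<union> (\<lambda>w. w @ [1]) ` words a (Suc b)"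
    by (auto simp: words_def)
qed (auto simp: words_def)

lemma words_ending_in_2:
  "{w \<in> words a (Suc b). w \<noteq> [] \<and> last w = 2} = (\<lambda>w. w @ [2]) ` words a b"
proof (intro equalityI subsetI)
  fix w assume w: "w \<in> {w \<in> words a (Suc b). w \<noteq> [] \<and> last w = 2}"
  then obtain u where "w = u @ [2]" by (metis (mono_tags, lifting) append_butlast_last_id mem_Collect_eq)
  with w show "w \<in> (\<lambda>w. w @ [2]) ` words a b"
    by (auto simp: words_def)
qed (auto simp: words_def)

lemma words_0_right: "words a 0 = {replicate a 1}"
proof (intro equalityI subsetI)
  have *: "w = replicate (length w) 1" if "set w \<subseteq> {1, 2}" "count_list w 2 = 0" for w :: "nat list"
    using that by (induction w) (auto split: if_splits)
  show "w \<in> {replicate a 1}" if "w \<in> words a 0" for w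
    using that *[of w] length_words[OF that] unfolding words_def by force
  have "replicate a 1 \<in> words a 0"
    by (induction a) (auto simp: words_def)
  then show "w \<in> words a 0" if "w \<in> {replicate a 1}" for w
    using that by simp
qed

lemma words_0_left: "words 0 b = {replicate b 2}"
proof (intro equalityI subsetI)
  have *: "w = replicate (length w) 2" if "set w \<subseteq> {1, 2}" "count_list w 1 = 0" for w :: "nat list"
    using that by (induction w) (auto split: if_splits)
  show "w \<in> {replicate b 2}" if "w \<in> words 0 b" for w
    using that *[of w] length_words[OF that] unfolding words_def by force
  have "replicate b 2 \<in> words 0 b"
    by (induction b) (auto simp: words_def)
  then show "w \<in> words 0 b" if "w \<in> {replicate b 2}" for w
    using that by simp
qed

lemma Des_snoc:
  "Des (w @ [c]) = (if w \<noteq> [] \<and> last w > c then insert (length w) (Des w) else Des w)"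
proof -
  have "i \<in> Des (w @ [c]) \<longleftrightarrow> i \<in> Des w \<or> (i = length w \<and> w \<noteq> [] \<and> last w > c)" for i
  proof (cases i "length w" rule: linorder_cases)
    case equal
    then show ?thesis
      by (cases "w = []") (simp_all add: Des_def nth_append last_conv_nth Suc_le_eq)
  qed (simp_all add: Des_def nth_append less_imp_diff_less)
  then show ?thesis by (intro set_eqI) (simp, blast)
qed

lemma length_notin_Des: "length w \<notin> Des w"
  by (simp add: Des_def)

section \<open>The generating function of descents and major index\<close>

definition weight :: "'a::comm_ring_1 \<Rightarrow> 'a \<Rightarrow> nat list \<Rightarrow> 'a" where
  "weight x q w = x ^ des w * q ^ maj w"

lemma weight_snoc:
  "weight x q (w @ [c]) =
     (if w \<noteq> [] \<and> last w > c then x * q ^ length w * weight x q w else weight x q w)"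
  by (simp add: weight_def des_def maj_def Des_snoc length_notin_Des finite_Des power_add)

lemma weight_snoc_2: "w \<in> words a b \<Longrightarrow> weight x q (w @ [2]) = weight x q w"
  using last_in_set[of w] unfolding weight_snoc words_def by fastforce

lemma weight_replicate: "weight x q (replicate n c) = 1"
proof -
  have "Des (replicate n c) = {}" by (auto simp: Des_def)
  then show ?thesis by (simp add: weight_def des_def maj_def)
qed

definition word_sum :: "'a::comm_ring_1 \<Rightarrow> 'a \<Rightarrow> nat \<Rightarrow> nat \<Rightarrow> 'a" where
  "word_sum x q a b = (\<Sum>w\<in>words a b. weight x q w)"

lemma word_sum_0 [simp]: "word_sum x q a 0 = 1" "word_sum x q 0 b = 1"
  by (simp_all add: word_sum_def words_0_right words_0_left weight_replicate)

lemma inj_snoc: "inj_on (\<lambda>w. w @ [c]) A"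
  by (simp add: inj_on_def)

text \<open>
  The last letter is \<open>2\<close> or \<open>1\<close>. Appending \<open>2\<close> never makes a descent. Appending \<open>1\<close> to a word in
  \<open>words a (Suc b)\<close> makes one, at position \<open>Suc (a + b)\<close>, exactly if that word ends in \<open>2\<close>; the words
  that do so correspond to \<open>words a b\<close> by deleting that \<open>2\<close>, which leaves the weight unchanged.
  The correction term replaces their weight by \<open>x q\<^bsup>a+b+1\<^esup>\<close> times itself.
\<close>

lemma word_sum_Suc_Suc:
  "word_sum x q (Suc a) (Suc b) =
     word_sum x q (Suc a) b + word_sum x q a (Suc b) + (x * q ^ Suc (a + b) - 1) * word_sum x q a b"
proof -
  let ?A = "words a (Suc b)" and ?E = "\<lambda>w. w \<noteq> [] \<and> last w = (2::nat)"
  have sum2: "(\<Sum>w\<in>words c d. weight x q (w @ [2])) = word_sum x q c d" for c d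
    unfolding word_sum_def by (intro sum.cong refl weight_snoc_2)
  have "weight x q (w @ [1]) =
          weight x q w + (if ?E w then (x * q ^ Suc (a + b) - 1) * weight x q w else 0)"
    if "w \<in> ?A" for w
  proof -
    have "last w > 1 \<longleftrightarrow> last w = 2" if "w \<noteq> []"
    proof -
      have "last w \<in> {1, 2}"
        using \<open>w \<in> ?A\<close> that last_in_set[of w] unfolding words_def by blast
      then show ?thesis by auto
    qed
    then show ?thesis
      using length_words[OF that] by (auto simp: weight_snoc algebra_simps)
  qed
  then have "(\<Sum>w\<in>?A. weight x q (w @ [1])) =
      word_sum x q a (Suc b) +
      (\<Sum>w\<in>?A. if ?E w then (x * q ^ Suc (a + b) - 1) * weight x q w else 0)"
    by (simp add: sum.distrib word_sum_def)
  also have "(\<Sum>w\<in>?A. if ?E w then (x * q ^ Suc (a + b) - 1) * weight x q w else 0) =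
      (\<Sum>w\<in>{w\<in>?A. ?E w}. (x * q ^ Suc (a + b) - 1) * weight x q w)"
    by (rule sum.inter_filter[symmetric]) (rule finite_words)
  also have "\<dots> = (x * q ^ Suc (a + b) - 1) * word_sum x q a b"
    unfolding words_ending_in_2 sum.reindex[OF inj_snoc] o_def
    by (simp add: sum2 flip: sum_distrib_left)
  finally have sum1: "(\<Sum>w\<in>?A. weight x q (w @ [1])) =
      word_sum x q a (Suc b) + (x * q ^ Suc (a + b) - 1) * word_sum x q a b" .
  have "word_sum x q (Suc a) (Suc b) =
      (\<Sum>w\<in>words (Suc a) b. weight x q (w @ [2])) + (\<Sum>w\<in>?A. weight x q (w @ [1]))"
    unfolding word_sum_def[of _ _ "Suc a" "Suc b"] words_Suc_Suc
    by (subst sum.union_disjoint) (auto simp: finite_words sum.reindex[OF inj_snoc])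
  then show ?thesis unfolding sum1 sum2 by (simp add: add.assoc)
qed

text \<open>
  The elementary symmetric polynomial \<open>e\<^sub>k(1, q, \<dots>, q\<^sup>n\<^sup>-\<^sup>1)\<close>, which equals \<open>q\<^bsup>k(k-1)/2\<^esup>\<close> times
  the Gaussian binomial coefficient. It is preferred to the latter because its recursion avoids
  the exponent \<open>n - k\<close> and fits the recursion for words.
\<close>

fun qesym :: "'a::comm_ring_1 \<Rightarrow> nat \<Rightarrow> nat \<Rightarrow> 'a" where
  "qesym q n 0 = 1"
| "qesym q 0 (Suc k) = 0"
| "qesym q (Suc n) (Suc k) = qesym q n (Suc k) + q ^ n * qesym q n k"

lemma qesym_eq_0: "n < k \<Longrightarrow> qesym q n k = 0"
  by (induction q n k rule: qesym.induct) auto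

text \<open>
  Combinatorially, a word is determined by its descents, and a descent by the numbers \<open>i\<close> of
  letters \<open>1\<close> and \<open>j\<close> of letters \<open>2\<close> up to its position. In a word with \<open>k\<close> descents the values
  \<open>i\<close> form an arbitrary \<open>k\<close>-subset of \<open>{0..<a}\<close> and the values \<open>j\<close> one of \<open>{1..b}\<close>, and the position
  is \<open>i + j\<close>. The proof instead checks that both sides satisfy the same recursion. The bound \<open>N\<close>
  is independent of \<open>a\<close> and \<open>b\<close> so that the sums occurring in the recursion run over the same
  range.
\<close>

lemma word_sum_eq:
  assumes "a \<le> N" "b \<le> N"
  shows "word_sum x q a b = (\<Sum>k\<le>N. x ^ k * q ^ k * qesym q a k * qesym q b k)"
proof -
  define S where "S a b = (\<Sum>k\<le>N. x ^ k * q ^ k * qesym q a k * qesym q b k)" for a b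
  have S0: "S a 0 = 1" "S 0 b = 1" for a b
    unfolding S_def by (subst sum.atMost_shift; simp)+
  have rec: "S (Suc a) (Suc b) = S (Suc a) b + S a (Suc b) + (x * q ^ Suc (a + b) - 1) * S a b"
    if "a < N" for a b
  proof -
    \<comment> \<open>The product of the two summands that the recursion for \<open>e\<^sub>k\<close> adds is the only part of
      \<open>S (Suc a) (Suc b)\<close> that inclusion-exclusion over the other three sums leaves uncovered.
      Since \<open>e\<^sub>N = 0\<close> for \<open>a < N\<close>, the index may stop at \<open>N - 1\<close>.\<close>
    have shift: "x * q ^ Suc (a + b) * S a b =
        (\<Sum>k<N. x ^ Suc k * q ^ Suc k * (q ^ a * qesym q a k) * (q ^ b * qesym q b k))"
      unfolding S_def using that
      by (simp add: lessThan_Suc_atMost[symmetric] qesym_eq_0 sum_distrib_left power_add mult_ac)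
    have "S (Suc a) (Suc b) + S a b - S (Suc a) b - S a (Suc b) = x * q ^ Suc (a + b) * S a b"
      unfolding shift unfolding S_def sum.atMost_shift
      by (simp add: algebra_simps flip: sum.distrib sum_subtractf)
    then show ?thesis by (simp add: algebra_simps)
  qed
  have "a \<le> N \<Longrightarrow> word_sum x q a b = S a b" for a b
  proof (induction a arbitrary: b)
    case 0 show ?case by (simp add: S0)
  next
    case (Suc a) 
    then show ?case
      by (induction b) (simp_all add: S0 rec word_sum_Suc_Suc)
  qed
  with assms show ?thesis by (simp add: S_def)
qed

section \<open>Symmetry of the coefficients and divisibility\<close>

text \<open>The \<open>q\<close>-Pochhammer symbol \<open>(q; q)\<^sub>n\<close>.\<close>

definition qpoch :: "'a::comm_ring_1 \<Rightarrow> nat \<Rightarrow> 'a" where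
  "qpoch q n = (\<Prod>i<n. 1 - q ^ Suc i)"

lemma qesym_diag: "qesym q n n = q ^ (n choose 2)"
proof (induction n)
  case (Suc n)
  have "Suc n choose 2 = n + (n choose 2)" by (simp add: numeral_2_eq_2)
  then show ?case using Suc by (simp add: qesym_eq_0 power_add)
qed (simp add: numeral_2_eq_2)

text \<open>
  The factorial formula for Gaussian binomial coefficients, written without division so that it
  makes sense in any commutative ring. The induction step rests on
  \<open>1 - q\<^bsup>k+l+2\<^esup> = (1 - q\<^bsup>l+1\<^esup>) + q\<^bsup>l+1\<^esup> (1 - q\<^bsup>k+1\<^esup>)\<close>.
\<close>

lemma qesym_qpoch:
  "qesym q (k + l) k * (qpoch q k * qpoch q l) = q ^ (k choose 2) * qpoch q (k + l)"
proof (induction k arbitrary: l)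
  case 0 show ?case by (simp add: qpoch_def numeral_2_eq_2)
next
  case (Suc k)
  note IH_k = Suc.IH
  show ?case
  proof (induction l)
    case 0 show ?case by (simp add: qesym_diag qpoch_def)
  next
    case (Suc l)
    have qpoch_Suc: "qpoch q (Suc n) = qpoch q n * (1 - q ^ Suc n)" for n
      by (simp add: qpoch_def)
    have ch: "Suc k choose 2 = k + (k choose 2)" by (simp add: numeral_2_eq_2)
    have "qesym q (Suc k + Suc l) (Suc k) * (qpoch q (Suc k) * qpoch q (Suc l)) =
        (qesym q (Suc k + l) (Suc k) * (qpoch q (Suc k) * qpoch q l)) * (1 - q ^ Suc l) +
        q ^ (k + Suc l) * (qesym q (k + Suc l) k * (qpoch q k * qpoch q (Suc l))) * (1 - q ^ Suc k)"
      by (simp add: qpoch_Suc algebra_simps)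
    also have "\<dots> = q ^ (Suc k choose 2) * qpoch q (Suc k + l) * (1 - q ^ Suc l) +
        q ^ (k + Suc l) * (q ^ (k choose 2) * qpoch q (k + Suc l)) * (1 - q ^ Suc k)"
      by (simp only: Suc.IH IH_k)
    also have "\<dots> = q ^ (Suc k choose 2) * (qpoch q (Suc k + l) * (1 - q ^ Suc (Suc k + l)))"
      by (simp add: ch power_add algebra_simps)
    finally show ?case by (simp add: qpoch_Suc)
  qed
qed

text \<open>
  The factorial formula is symmetric in \<open>k\<close> and \<open>l\<close> up to the power of \<open>q\<close>. The \<open>q\<close>-Pochhammer
  symbols cancel because \<open>q\<close> is not a root of unity.
\<close>

lemma qesym_symmetric:
  fixes q :: "'a::idom"
  assumes "\<And>n. n > 0 \<Longrightarrow> q ^ n \<noteq> 1"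
  shows "qesym q (k + l) k * q ^ (l choose 2) = qesym q (k + l) l * q ^ (k choose 2)"
proof -
  have nz: "qpoch q n \<noteq> 0" for n
    using assms[of "Suc _"] by (auto simp: qpoch_def)
  have "(qesym q (k + l) k * q ^ (l choose 2)) * (qpoch q k * qpoch q l) =
      (qesym q (k + l) k * (qpoch q k * qpoch q l)) * q ^ (l choose 2)"
    by (simp only: mult_ac)
  also have "\<dots> = (qesym q (l + k) l * (qpoch q l * qpoch q k)) * q ^ (k choose 2)"
    unfolding qesym_qpoch by (simp add: mult_ac add.commute)
  also have "\<dots> = (qesym q (k + l) l * q ^ (k choose 2)) * (qpoch q k * qpoch q l)"
    by (simp add: mult_ac add.commute)
  finally show ?thesis using nz by simp
qed

text \<open>
  Squaring turns the exponents of \<open>qesym_symmetric\<close> into \<open>k (k - 1)\<close> and \<open>l (l - 1)\<close>, and the extra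
  factors \<open>q\<^sup>k\<close> and \<open>q\<^sup>l\<close> complete them to \<open>k\<^sup>2\<close> and \<open>l\<^sup>2\<close>, whose difference is \<open>r (l - k)\<close>.
\<close>

lemma coefficient_symmetric:
  fixes q :: "'a::idom"
  assumes "\<And>n. n > 0 \<Longrightarrow> q ^ n \<noteq> 1" "q \<noteq> 0" "k \<le> l" and r: "k + l = r"
  shows "q ^ l * (qesym q r l)\<^sup>2 = q ^ k * (qesym q r k)\<^sup>2 * (q ^ r) ^ (l - k)"
proof -
  have ch: "2 * (n choose 2) + n = n\<^sup>2" for n :: nat
    by (induction n) (simp_all add: numeral_2_eq_2)
  have q: "q ^ n * (q ^ (n choose 2))\<^sup>2 = q ^ n\<^sup>2" for n
    by (simp add: power_add flip: ch[of n] power_mult) (simp add: mult.commute)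
  have "l\<^sup>2 = k\<^sup>2 + r * (l - k)"
    using assms(3) r[symmetric] by (auto simp: le_iff_add power2_eq_square algebra_simps)
  then have l: "q ^ l\<^sup>2 = q ^ k\<^sup>2 * (q ^ r) ^ (l - k)"
    by (simp add: power_add power_mult)
  have "(q ^ l * (qesym q r l)\<^sup>2) * q ^ k\<^sup>2 = q ^ l * q ^ k * (qesym q r l * q ^ (k choose 2))\<^sup>2"
    unfolding q[symmetric] by (simp add: power_mult_distrib mult_ac)
  also have "\<dots> = q ^ l * q ^ k * (qesym q r k * q ^ (l choose 2))\<^sup>2"
    using qesym_symmetric[OF assms(1), of k l] r by simp
  also have "\<dots> = q ^ k * (qesym q r k)\<^sup>2 * q ^ l\<^sup>2"
    unfolding q[symmetric] by (simp add: power_mult_distrib mult_ac)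
  finally show ?thesis using \<open>q \<noteq> 0\<close> unfolding l by simp
qed

lemma one_plus_dvd_odd_power:
  fixes y :: "'a::comm_ring_1"
  assumes "odd n"
  shows "1 + y dvd 1 + y ^ n"
proof -
  have "y - (-1) dvd y ^ n - (-1) ^ n" 
    unfolding power_diff_sumr2 by simp
  with assms show ?thesis by (simp add: add.commute)
qed

text \<open>
  For odd \<open>r\<close> the involution \<open>k \<mapsto> r - k\<close> has no fixed point, so the sum splits into pairs
  \<open>c\<^sub>k x\<^sup>k (1 + (x q\<^sup>r)\<^bsup>r-2k\<^esup>)\<close>.
\<close>

lemma word_sum_dvd:
  fixes x q :: "'a::idom"
  assumes "\<And>n. n > 0 \<Longrightarrow> q ^ n \<noteq> 1" "q \<noteq> 0" and "odd r"
  shows "1 + x * q ^ r dvd word_sum x q r r"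
proof -
  from \<open>odd r\<close> obtain m where m: "r = 2 * m + 1" by (elim oddE)
  define t where "t k = x ^ k * (q ^ k * (qesym q r k)\<^sup>2)" for k
  have "word_sum x q r r = (\<Sum>k\<le>r. t k)"
    by (simp add: word_sum_eq[of r r] t_def power2_eq_square mult_ac)
  also have "\<dots> = (\<Sum>k\<le>m. t k) + (\<Sum>k\<in>{m<..r}. t k)"
  proof -
    have "{..r} = {..m} \<union> {m<..r}" using m by auto
    then show ?thesis by (simp only:) (rule sum.union_disjoint, auto)
  qed
  also have "(\<Sum>k\<in>{m<..r}. t k) = (\<Sum>k\<le>m. t (r - k))"
    by (rule sum.reindex_bij_witness[of _ "\<lambda>k. r - k" "\<lambda>k. r - k"]) (auto simp: m)
  finally have "word_sum x q r r = (\<Sum>k\<le>m. t k + t (r - k))"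
    by (simp add: sum.distrib)
  moreover have "1 + x * q ^ r dvd t k + t (r - k)" if "k \<le> m" for k
  proof -
    have k: "k \<le> r - k" "k + (r - k) = r" using that m by auto
    have "x ^ (r - k) = x ^ k * x ^ (r - k - k)"
      using k by (simp flip: power_add)
    then have "t k + t (r - k) = t k * (1 + (x * q ^ r) ^ (r - k - k))"
      unfolding t_def using coefficient_symmetric[OF assms(1,2) k]
      by (simp add: power_mult_distrib algebra_simps)
    moreover have "odd (r - k - k)" using that m by auto
    ultimately show ?thesis
      using dvd_mult[OF one_plus_dvd_odd_power[of "r - k - k" "x * q ^ r"], of "t k"] by simp
  qed
  ultimately show ?thesis by (auto intro!: dvd_sum)
qed

section \<open>Sums of squares of binomial coefficients\<close>

lemma coeff_linear_power:
  "coeff ([:c, 1:] ^ n) k = of_nat (n choose k) * (c :: 'a::comm_ring_1) ^ (n - k)"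
proof -
  have "[:c, 1:] ^ n = (monom 1 1 + [:c:]) ^ n" by (simp add: monom_altdef)
  also have "\<dots> = (\<Sum>i\<le>n. monom (of_nat (n choose i) * c ^ (n - i)) i)"
    unfolding binomial_ring
    by (intro sum.cong refl) (simp add: monom_power poly_const_pow smult_monom mult_ac of_nat_poly)
  finally show ?thesis by (simp add: coeff_sum binomial_eq_0)
qed

text \<open>
  Both sides are the coefficient of \<open>t\<^sup>r\<close> in \<open>((1 + t)(x + t))\<^sup>r = ((x + t\<^sup>2) + (1 + x) t)\<^sup>r\<close>: on the
  left the two factors are expanded separately, on the right the binomial theorem is applied to
  the two summands, where only even powers \<open>(x + t\<^sup>2)\<^bsup>2j\<^esup>\<close> contribute.
\<close>

lemma sum_binomial_squares:
  fixes x :: "'a::comm_ring_1"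
  shows "(\<Sum>k\<le>r. (of_nat (r choose k))\<^sup>2 * x ^ k) =
     (\<Sum>j\<le>r div 2. of_nat ((r choose (2*j)) * (2*j choose j)) * x ^ j * (1 + x) ^ (r - 2*j))"
proof -
  let ?T = "([:1, 1:] * [:x, 1:]) ^ r"
  have "coeff ?T r = (\<Sum>k\<le>r. coeff ([:1, 1:] ^ r) k * coeff ([:x, 1:] ^ r) (r - k))"
    by (simp only: power_mult_distrib coeff_mult)
  also have "\<dots> = (\<Sum>k\<le>r. (of_nat (r choose k))\<^sup>2 * x ^ k)"
    by (intro sum.cong refl)
       (simp add: coeff_linear_power power2_eq_square mult.assoc flip: binomial_symmetric)
  finally have 1: "coeff ?T r = (\<Sum>k\<le>r. (of_nat (r choose k))\<^sup>2 * x ^ k)" .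
  have sq: "coeff ([:x, 0, 1:] ^ i) i = (if even i then of_nat (i choose (i div 2)) * x ^ (i div 2) else 0)" for i
  proof -
    have "[:x, 0, 1:] = monom 1 2 + [:x:]"
      by (simp add: monom_altdef power2_eq_square)
    then have "[:x, 0, 1:] ^ i = (\<Sum>k\<le>i. monom (of_nat (i choose k) * x ^ (i - k)) (2 * k))"
      unfolding binomial_ring
      by (auto intro!: sum.cong simp: binomial_ring monom_power poly_const_pow smult_monom mult_ac of_nat_poly)
    then have "coeff ([:x, 0, 1:] ^ i) i =
        (\<Sum>k\<le>i. if 2 * k = i then of_nat (i choose k) * x ^ (i - k) else 0)"
      by (simp add: coeff_sum)
    also have "\<dots> = (\<Sum>k\<in>{k. k \<le> i \<and> 2 * k = i}. of_nat (i choose k) * x ^ (i - k))"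
      by (simp add: sum.inter_filter[symmetric])
    also have "{k. k \<le> i \<and> 2 * k = i} = (if even i then {i div 2} else {})" by auto
    finally show ?thesis by auto
  qed
  have "[:1, 1:] * [:x, 1:] = [:x, 0, 1:] + monom (1 + x) 1"
    by (simp add: monom_altdef)
  moreover have "of_nat c * p * monom d 1 ^ n = smult (of_nat c * d ^ n) (monom 1 n * p)"
    for c d n and p :: "'a poly"
  proof -
    have "of_nat c * p * monom d 1 ^ n = of_nat c * (smult (d ^ n) (monom 1 n) * p)"
      by (simp add: smult_monom monom_power mult_ac)
    then show ?thesis by (simp add: of_nat_poly mult.commute[of "of_nat c" "d ^ n"])
  qed
  ultimately have "?T = (\<Sum>i\<le>r. smult (of_nat (r choose i) * (1 + x) ^ (r - i)) (monom 1 (r - i) * [:x, 0, 1:] ^ i))"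
    by (simp only: binomial_ring[of "[:x, 0, 1:]" "monom (1 + x) 1"])
  then have "coeff ?T r = (\<Sum>i\<le>r. of_nat (r choose i) * (1 + x) ^ (r - i) * coeff ([:x, 0, 1:] ^ i) i)"
    by (auto simp: coeff_sum coeff_monom_mult intro!: sum.cong)
  also have "\<dots> = (\<Sum>i\<in>{i. i \<le> r \<and> even i}. of_nat ((r choose i) * (i choose (i div 2))) * x ^ (i div 2) * (1 + x) ^ (r - i))"
    by (simp add: sq sum.inter_filter[symmetric] if_distrib mult_ac cong: if_cong)
  also have "\<dots> = (\<Sum>j\<le>r div 2. of_nat ((r choose (2*j)) * (2*j choose j)) * x ^ j * (1 + x) ^ (r - 2*j))"
    by (rule sum.reindex_bij_witness[of _ "\<lambda>j. 2 * j" "\<lambda>i. i div 2"]) auto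
  finally show ?thesis using 1 by simp
qed

text \<open>
  The quotient of \<open>\<Sum>\<^sub>k (r choose k)\<^sup>2 x\<^sup>k\<close> by \<open>1 + x\<close> for odd \<open>r\<close>. The exponent of \<open>1 + x\<close> is \<open>r - 2j - 1\<close>,
  written in a form that shows that it is even.
\<close>

definition cofactor :: "nat \<Rightarrow> 'a::comm_ring_1 \<Rightarrow> 'a" where
  "cofactor r x = (\<Sum>j\<le>r div 2. of_nat ((r choose (2*j)) * (2*j choose j)) * x ^ j * (1 + x) ^ (2 * (r div 2 - j)))"

lemma sum_binomial_squares_odd:
  fixes x :: "'a::comm_ring_1"
  assumes "odd r"
  shows "(\<Sum>k\<le>r. (of_nat (r choose k))\<^sup>2 * x ^ k) = (1 + x) * cofactor r x"
  unfolding sum_binomial_squares cofactor_def sum_distrib_left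
proof (intro sum.cong refl)
  fix j assume "j \<in> {..r div 2}"
  then have "r - 2 * j = Suc (2 * (r div 2 - j))" using assms by (auto elim!: oddE)
  then show "of_nat ((r choose (2*j)) * (2*j choose j)) * x ^ j * (1 + x) ^ (r - 2*j) =
      (1 + x) * (of_nat ((r choose (2*j)) * (2*j choose j)) * x ^ j * (1 + x) ^ (2 * (r div 2 - j)))"
    by (simp add: mult_ac)
qed

text \<open>
  For \<open>|z| = 1\<close>, \<open>(1 + z)\<^sup>2 = s z\<close> with \<open>s = 2 + 2 Re z \<ge> 0\<close>. Substituting this makes the cofactor \<open>z\<^sup>m\<close>
  times a polynomial in \<open>s\<close> with positive coefficients. Its constant term, the summand with \<open>j = m\<close>,
  keeps it positive even for \<open>s = 0\<close>, that is \<open>z = -1\<close>.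
\<close>

lemma cofactor_unit_circle_nonzero:
  fixes z :: complex
  assumes z: "cmod z = 1"
  shows "cofactor r z \<noteq> 0"
proof -
  define m where "m = r div 2"
  define s where "s = 2 + 2 * Re z"
  define t where "t j = real ((r choose (2*j)) * (2*j choose j)) * s ^ (m - j)" for j
  have s: "(1 + z)\<^sup>2 = z * of_real s"
  proof -
    have "z * cnj z = 1" using z by (metis complex_norm_square mult_1 of_real_1 one_power2)
    moreover have "complex_of_real s = 2 + (z + cnj z)" by (simp add: s_def complex_add_cnj)
    ultimately show ?thesis by (simp add: power2_eq_square algebra_simps)
  qed
  have "s \<ge> 0" using abs_Re_le_cmod[of z] z by (simp add: s_def)
  have "cofactor r z = z ^ m * of_real (\<Sum>j\<le>m. t j)"
    unfolding cofactor_def m_def[symmetric] of_real_sum sum_distrib_left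
  proof (intro sum.cong refl)
    fix j assume "j \<in> {..m}"
    then have "z ^ m = z ^ j * z ^ (m - j)" by (simp flip: power_add)
    moreover have "(1 + z) ^ (2 * (m - j)) = (z * of_real s) ^ (m - j)"
      by (simp only: power_mult s)
    ultimately show "of_nat ((r choose (2*j)) * (2*j choose j)) * z ^ j * (1 + z) ^ (2 * (m - j)) =
        z ^ m * of_real (t j)"
      by (simp add: t_def power_mult_distrib mult_ac)
  qed
  moreover have "(\<Sum>j\<le>m. t j) > 0"
  proof (rule sum_pos2)
    show "t m > 0" by (auto simp: t_def m_def zero_less_binomial_iff)
    show "t j \<ge> 0" for j using \<open>s \<ge> 0\<close> by (simp add: t_def)
  qed auto
  moreover have "z \<noteq> 0" using z by auto
  ultimately show ?thesis by (simp del: of_real_sum)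
qed

section \<open>Specialisation at q = 1\<close>

definition at_q1 :: "int poly poly \<Rightarrow> complex poly" where
  "at_q1 = map_poly (\<lambda>c. of_int (poly c 1))"

lemma coeff_at_q1: "coeff (at_q1 p) n = of_int (poly (coeff p n) 1)"
  by (simp add: at_q1_def coeff_map_poly)

lemma at_q1_simps [simp]:
  "at_q1 0 = 0" "at_q1 1 = 1"
  "at_q1 (p + p') = at_q1 p + at_q1 p'"
  "at_q1 (p * p') = at_q1 p * at_q1 p'"
  by (rule poly_eqI; simp add: coeff_at_q1 coeff_mult poly_sum coeff_1)+

lemma at_q1_power [simp]: "at_q1 (p ^ n) = at_q1 p ^ n"
  by (induction n) simp_all

lemma at_q1_sum: "at_q1 (sum f A) = (\<Sum>i\<in>A. at_q1 (f i))"
  by (induction A rule: infinite_finite_induct) simp_all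

lemma at_q1_const: "at_q1 [:c:] = [:of_int (poly c 1):]"
  by (simp add: at_q1_def map_poly_pCons)

lemma at_q1_X: "at_q1 [:0, 1:] = [:0, 1:]"
  by (simp add: at_q1_def map_poly_pCons)

abbreviation "X \<equiv> [:0, 1 :: int poly:]"
abbreviation "Q \<equiv> [:[:0, 1 :: int:]:]"

lemma at_q1_Q: "at_q1 Q = 1"
  by (simp add: at_q1_const one_pCons)

lemma at_q1_bimonom: "at_q1 (bimonom a b) = [:0, 1:] ^ a"
  by (simp only: bimonom_eq at_q1_simps at_q1_power at_q1_X at_q1_Q power_one mult_1_right)

lemma at_q1_qesym: "at_q1 (qesym Q n k) = of_nat (n choose k)"
proof (induction Q n k rule: qesym.induct)
  case (3 n k)
  then show ?case by (simp add: at_q1_const one_pCons[symmetric] add.commute)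
qed simp_all

lemma C_poly_eq_word_sum: "C_poly r = word_sum X Q r r"
  by (simp add: C_poly_def word_sum_def weight_def balanced_words_eq bimonom_eq)

lemma at_q1_C_poly: "at_q1 (C_poly r) = (\<Sum>k\<le>r. (of_nat (r choose k))\<^sup>2 * [:0, 1:] ^ k)"
  by (simp only: C_poly_eq_word_sum word_sum_eq[of r r r, OF order_refl order_refl] at_q1_sum
      at_q1_simps at_q1_power at_q1_X at_q1_Q at_q1_qesym power_one mult_1_left power2_eq_square mult_ac)

lemma poly_cofactor: "poly (cofactor r [:0, 1:]) z = cofactor r z"
  by (simp add: cofactor_def poly_sum)

lemma poly_C_poly_0: "poly (C_poly r) 0 = 1"
proof -
  have "poly (C_poly r) 0 = (\<Sum>k\<le>r. if k = 0 then 1 else 0)"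
    unfolding C_poly_eq_word_sum word_sum_eq[of r r r, OF order_refl order_refl] poly_sum
    by (intro sum.cong refl) simp
  then show ?thesis by simp
qed

lemma C_poly_dvd:
  assumes "odd r"
  shows "1 + bimonom 1 r dvd C_poly r"
proof -
  have "Q ^ n \<noteq> 1" if "n > 0" for n
  proof
    assume "Q ^ n = 1"
    then have "poly (poly (Q ^ n) 0) 0 = poly (poly 1 0) 0" by simp
    with that show False by (simp add: power_0_left)
  qed
  from word_sum_dvd[OF this _ assms, of X] show ?thesis
    by (simp add: C_poly_eq_word_sum bimonom_eq)
qed

section \<open>Unitary factors\<close>

lemma poly_at_q1_substitution:
  "poly (at_q1 (poly (map_poly of_int g) (bimonom a b))) z = poly (map_poly of_int g) (z ^ a)"
proof (induction g)
  case (pCons c g)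
  have "at_q1 (of_int c) = [:of_int c:]"
    by (simp add: of_int_poly at_q1_const)
  with pCons show ?case by (simp add: map_poly_pCons at_q1_bimonom)
qed simp

lemma substitution_of_constant_in_x:
  "\<exists>h. poly (map_poly of_int g) (bimonom 0 b) = [:h:]"
proof (induction g)
  case (pCons c g)
  then obtain h where "poly (map_poly of_int g) (bimonom 0 b) = [:h:]" by blast
  then have "poly (map_poly of_int (pCons c g)) (bimonom 0 b) = of_int c + bimonom 0 b * [:h:]"
    by (simp add: map_poly_pCons)
  also have "\<dots> = [:[:c:] + monom 1 b * h:]"
    by (simp add: bimonom_def monom_0 of_int_poly)
  finally show ?case by blast
qed simp

text \<open>
  Two conditions on \<open>p\<close> that exclude nonconstant unitary divisors \<open>g(x\<^sup>a q\<^sup>b)\<close>: the condition at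
  \<open>x = 0\<close> deals with \<open>a = 0\<close>, the condition at \<open>q = 1\<close> with \<open>a > 0\<close>, where \<open>a\<close>-th roots of roots of \<open>g\<close>
  would be zeros of \<open>p\<close> on the unit circle.
\<close>

lemma unitary_dvd_imp_constant:
  assumes f: "unitary f" and dvd: "f dvd p"
    and p0: "poly p 0 dvd 1"
    and p1: "\<And>z. cmod z = 1 \<Longrightarrow> poly (at_q1 p) z \<noteq> 0"
  shows "\<exists>c. f = [:[:c:]:]"
proof -
  from f obtain a b g where fg: "f = poly (map_poly of_int g) (bimonom a b)"
    and roots: "\<And>z::complex. poly (map_poly of_int g) z = 0 \<Longrightarrow> cmod z = 1"
    unfolding unitary_def by blast
  from dvd obtain h where p: "p = f * h" by (elim dvdE)
  show ?thesis
  proof (cases "a = 0")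
    case True
    then obtain c where c: "f = [:c:]" using fg substitution_of_constant_in_x by blast
    with p have "c dvd poly p 0" by simp
    then have "is_unit c" using p0 dvd_trans by blast
    then show ?thesis unfolding c by (auto elim!: is_unit_polyE)
  next
    case False
    have nz: "poly (map_poly of_int g) (z ^ a) \<noteq> (0::complex)" for z
    proof
      assume 0: "poly (map_poly of_int g) (z ^ a) = (0::complex)"
      then have "cmod z ^ a = 1" using roots by (simp flip: norm_power)
      then have "cmod z = 1" using False power_eq_imp_eq_base[of "cmod z" a 1] by simp
      moreover have "poly (at_q1 p) z = 0"
        by (simp add: p fg poly_at_q1_substitution 0)
      ultimately show False using p1 by blast
    qed
    have "constant (poly (map_poly of_int g :: complex poly))"
    proof (rule ccontr)
      assume "\<not> ?thesis"
      then obtain w :: complex where w: "poly (map_poly of_int g) w = 0"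
        using fundamental_theorem_of_algebra by blast
      then have "w \<noteq> 0" using roots by force
      with False have "card {z. z ^ a = w} \<noteq> 0" by (simp add: card_nth_roots)
      then have "\<exists>z. z ^ a = w" by (metis (mono_tags) Collect_empty_eq card.empty)
      with nz w show False by blast
    qed
    then have "degree g = 0"
      by (simp add: constant_degree degree_map_poly)
    then obtain c where "g = [:c:]" by (elim degree_eq_zeroE)
    then show ?thesis using fg by (auto simp: map_poly_pCons of_int_poly)
  qed
qed

theorem proposition2p4:
  fixes r :: nat
  assumes "odd r"
  shows "\<exists>Ct :: int poly poly.
           C_poly r = (1 + bimonom 1 r) * Ct \<and> (\<nexists>f. unitary_factor f Ct)"
proof -
  from C_poly_dvd[OF assms] obtain Ct where Ct: "C_poly r = (1 + bimonom 1 r) * Ct"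
    by (elim dvdE)
  have "poly Ct 0 dvd 1"
  proof
    show "1 = poly Ct 0 * poly (1 + bimonom 1 r) 0"
      using poly_C_poly_0[of r] by (simp add: Ct mult.commute)
  qed
  moreover have "poly (at_q1 Ct) z \<noteq> 0" if "cmod z = 1" for z
  proof -
    \<comment> \<open>Cancelling \<open>1 + x\<close> between polynomials, rather than between values at \<open>z\<close>, is what covers
      \<open>z = -1\<close>.\<close>
    have "(1 + [:0, 1:]) * at_q1 Ct = (1 + [:0, 1:]) * cofactor r [:0, 1:]"
      using at_q1_C_poly[of r] sum_binomial_squares_odd[OF assms, of "[:0, 1::complex:]"]
      by (simp add: Ct at_q1_bimonom)
    moreover have "1 + [:0, 1:] \<noteq> (0 :: complex poly)" by (simp add: one_pCons)
    ultimately have "at_q1 Ct = cofactor r [:0, 1:]" by simp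
    then show ?thesis using cofactor_unit_circle_nonzero[OF that] by (simp add: poly_cofactor)
  qed
  ultimately have "\<nexists>f. unitary_factor f Ct"
    unfolding unitary_factor_def using unitary_dvd_imp_constant by blast
  with Ct show ?thesis by blast
qed

end
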